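(* Let $G$ be a finite simple connected graph with $n$ vertices and at least one edge, with maximum degree $\Delta$, minimum degree $\delta$, and largest eigenvalue $\lambda_1$. Then $$DSO(G)\le \frac{n\lambda_1}{2}\cdot\frac{\sqrt{\Delta^2+\delta^2}}{\Delta+\delta}.$$ Equality holds if and only if $G$ is a regular graph.
   Context: For a finite simple graph $G=(V(G),E(G))$, $d_u$ denotes the degree of the vertex $u$. The largest eigenvalue of $G$ is the largest eigenvalue of its adjacency matrix. The Diminished Sombor index is $DSO(G)=\sum_{uv\in E(G)}\frac{\sqrt{d_u^2+d_v^2}}{d_u+d_v}$. *)

theory Defs
  imports "Graph_Theory.Graph_Theory" "Jordan_Normal_Form.Spectral_Radius"
begin

text \<open>
  A finite simple graph is modelled by the locale \<^locale>\<open>graph\<close>: a finite symmetric digraph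
  without loops or parallel arcs.  An undirected edge \<open>{u, v}\<close> corresponds to exactly the two
  arcs from \<open>u\<close> to \<open>v\<close> and from \<open>v\<close> to \<open>u\<close>, so the degree of a vertex is its
  \<^const>\<open>out_degree\<close>, and an undirected edge is the set of the two ends of an arc.
\<close>

definition edges :: "('a, 'b) pre_digraph \<Rightarrow> 'a set set" where
  "edges G = (\<lambda>a. {tail G a, head G a}) ` arcs G"

definition max_degree :: "('a, 'b) pre_digraph \<Rightarrow> nat" where
  "max_degree G = Max (out_degree G ` verts G)"

definition min_degree :: "('a, 'b) pre_digraph \<Rightarrow> nat" where
  "min_degree G = Min (out_degree G ` verts G)"

definition regular_graph :: "('a, 'b) pre_digraph \<Rightarrow> bool" where
  "regular_graph G \<longleftrightarrow> (\<exists>k. \<forall>v \<in> verts G. out_degree G v = k)"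

text \<open>
  For an edge \<open>e = {u, v}\<close> (with \<open>u \<noteq> v\<close>, as there are no loops) the sums over \<open>w \<in> e\<close> below
  are \<open>d\<^sub>u\<^sup>2 + d\<^sub>v\<^sup>2\<close> and \<open>d\<^sub>u + d\<^sub>v\<close>.
\<close>

definition DSO :: "('a, 'b) pre_digraph \<Rightarrow> real" where
  "DSO G = (\<Sum>e \<in> edges G.
     sqrt (\<Sum>w \<in> e. (real (out_degree G w))\<^sup>2) / (\<Sum>w \<in> e. real (out_degree G w)))"

definition vertex_orderings :: "('a, 'b) pre_digraph \<Rightarrow> 'a list set" where
  "vertex_orderings G = {vs. distinct vs \<and> set vs = verts G}"

definition adjacency_matrix :: "('a, 'b) pre_digraph \<Rightarrow> 'a list \<Rightarrow> real mat" where
  "adjacency_matrix G vs =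
     mat (length vs) (length vs) (\<lambda>(i, j). if vs ! i \<rightarrow>\<^bsub>G\<^esub> vs ! j then 1 else 0)"

text \<open>
  The adjacency matrix depends on the ordering of the vertices, its eigenvalues do not; see
  \<open>graph_spectrum_eq\<close> below.
\<close>

definition graph_spectrum :: "('a, 'b) pre_digraph \<Rightarrow> real set" where
  "graph_spectrum G = (\<Union>vs \<in> vertex_orderings G. spectrum (adjacency_matrix G vs))"

definition largest_eigenvalue :: "('a, 'b) pre_digraph \<Rightarrow> real" where
  "largest_eigenvalue G = Max (graph_spectrum G)"

lemma sum_vertex_ordering:
  assumes "vs \<in> vertex_orderings G"
  shows "(\<Sum>v \<in> verts G. f v) = (\<Sum>j < length vs. f (vs ! j))"
proof -
  have "bij_betw (\<lambda>j. vs ! j) {..<length vs} (verts G)"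
    using assms by (intro bij_betw_nth) (auto simp: vertex_orderings_def)
  then show ?thesis by (simp add: sum.reindex_bij_betw)
qed

lemma spectrum_adjacency_matrix_iff:
  assumes vs: "vs \<in> vertex_orderings G"
  shows "k \<in> spectrum (adjacency_matrix G vs) \<longleftrightarrow>
    (\<exists>f. (\<exists>u \<in> verts G. f u \<noteq> 0) \<and>
      (\<forall>u \<in> verts G. (\<Sum>v \<in> verts G. (if u \<rightarrow>\<^bsub>G\<^esub> v then 1 else 0) * f v) = k * f u))"
    (is "?L \<longleftrightarrow> (\<exists>f. ?P f)")
proof
  let ?n = "length vs"
  have sv: "set vs = verts G" and dist: "distinct vs"
    using vs by (auto simp: vertex_orderings_def)
  have dim: "dim_row (adjacency_matrix G vs) = ?n"
    by (simp add: adjacency_matrix_def)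
  have mv: "(adjacency_matrix G vs *\<^sub>v x) $ i =
      (\<Sum>j < ?n. (if vs ! i \<rightarrow>\<^bsub>G\<^esub> vs ! j then 1 else 0) * x $ j)"
    if "i < ?n" "x \<in> carrier_vec ?n" for x i
    using that
    by (auto simp: adjacency_matrix_def scalar_prod_def atLeast0LessThan intro!: sum.cong)
  {
    assume ?L
    then obtain x where x: "x \<in> carrier_vec ?n" "x \<noteq> 0\<^sub>v ?n"
      and eq: "adjacency_matrix G vs *\<^sub>v x = k \<cdot>\<^sub>v x"
      by (auto simp: spectrum_def eigenvalue_def eigenvector_def dim)
    define f where "f v = x $ (THE i. i < ?n \<and> vs ! i = v)" for v
    have f: "f (vs ! i) = x $ i" if "i < ?n" for i
    proof -
      have "(THE j. j < ?n \<and> vs ! j = vs ! i) = i"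
        using that dist by (intro the_equality) (auto simp: nth_eq_iff_index_eq)
      then show ?thesis by (simp add: f_def)
    qed
    obtain i where i: "i < ?n" "x $ i \<noteq> 0"
      using x by (metis carrier_vecD eq_vecI index_zero_vec)
    have "?P f"
    proof (intro conjI ballI)
      show "\<exists>u \<in> verts G. f u \<noteq> 0"
        using i f[OF i(1)] sv nth_mem by metis
    next
      fix u assume "u \<in> verts G"
      then obtain l where l: "l < ?n" "u = vs ! l"
        using sv by (metis in_set_conv_nth)
      have "(adjacency_matrix G vs *\<^sub>v x) $ l = k * x $ l"
        using eq x l by auto
      then show "(\<Sum>v \<in> verts G. (if u \<rightarrow>\<^bsub>G\<^esub> v then 1 else 0) * f v) = k * f u"
        unfolding sum_vertex_ordering[OF vs] using l x by (simp add: mv f)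
    qed
    then show "\<exists>f. ?P f" by blast
  next
    assume "\<exists>f. ?P f"
    then obtain f where f: "?P f" by blast
    define x where "x = vec ?n (\<lambda>i. f (vs ! i))"
    have x: "x \<in> carrier_vec ?n" by (simp add: x_def)
    obtain l where l: "l < ?n" "f (vs ! l) \<noteq> 0"
      using f sv by (metis in_set_conv_nth)
    have "x \<noteq> 0\<^sub>v ?n"
      using l by (metis x_def index_vec index_zero_vec(1))
    moreover have "adjacency_matrix G vs *\<^sub>v x = k \<cdot>\<^sub>v x"
    proof (rule eq_vecI)
      fix i assume "i < dim_vec (k \<cdot>\<^sub>v x)"
      then have i: "i < ?n" by (simp add: x_def)
      then have "vs ! i \<in> verts G" using sv nth_mem by blast
      with f have "(\<Sum>v \<in> verts G. (if vs ! i \<rightarrow>\<^bsub>G\<^esub> v then 1 else 0) * f v) = k * f (vs ! i)"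
        by blast
      then show "(adjacency_matrix G vs *\<^sub>v x) $ i = (k \<cdot>\<^sub>v x) $ i"
        unfolding sum_vertex_ordering[OF vs] using i by (simp add: mv[OF i x]) (simp add: x_def)
    qed (simp add: x_def dim)
    ultimately show ?L
      using x by (auto simp: spectrum_def eigenvalue_def eigenvector_def dim)
  }
qed

lemma graph_spectrum_eq:
  assumes "vs \<in> vertex_orderings G"
  shows "graph_spectrum G = spectrum (adjacency_matrix G vs)"
  using assms by (auto simp: graph_spectrum_def spectrum_adjacency_matrix_iff)

end

theory Submission
  imports Defs "HOL-Analysis.Function_Topology"
begin

text \<open>
  Write \<open>m\<close> for the number of edges and \<open>S = sqrt (\<Delta>\<^sup>2 + \<delta>\<^sup>2) / (\<Delta> + \<delta>)\<close>.  The quotient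
  \<open>sqrt (a\<^sup>2 + b\<^sup>2) / (a + b)\<close> depends only on the ratio of \<open>a\<close> and \<open>b\<close> and grows as that ratio
  moves away from \<open>1\<close>, so among degrees in \<open>[\<delta>, \<Delta>]\<close> it is largest for the pair \<open>\<Delta>, \<delta>\<close>
  (\<open>sombor_quotient_le\<close>).  Hence \<open>DSO G \<le> m * S\<close>.  On the other hand the all-ones vector has
  Rayleigh quotient \<open>2 * m / n\<close>, which is at most \<open>\<lambda>\<^sub>1\<close> (\<open>rayleigh_largest_eigenvalue\<close>), so
  \<open>m * S \<le> n * \<lambda>\<^sub>1 / 2 * S\<close>.

  Since \<open>S > 0\<close>, equality in the theorem forces \<open>2 * m = n * \<lambda>\<^sub>1\<close>.  Then the all-ones vector
  maximises the Rayleigh quotient, hence it is an eigenvector (\<open>rayleigh_equality\<close>), and this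
  says that all degrees equal \<open>\<lambda>\<^sub>1\<close>.  Conversely, in a \<open>k\<close>-regular graph every summand of
  \<open>DSO G\<close> equals \<open>S\<close>, and \<open>\<lambda>\<^sub>1 = k = 2 * m / n\<close>.

  The Rayleigh principle is proved for symmetric weights on a finite set: the quadratic
  form attains its maximum on the unit sphere by compactness, and a maximiser is an eigenvector
  because the first variation of the form vanishes there.
\<close>

section \<open>The Rayleigh principle on a finite set\<close>

definition quadratic_form :: "'a set \<Rightarrow> ('a \<Rightarrow> 'a \<Rightarrow> real) \<Rightarrow> ('a \<Rightarrow> real) \<Rightarrow> real" where
  "quadratic_form V A x = (\<Sum>u\<in>V. x u * (\<Sum>v\<in>V. A u v * x v))"

lemma quadratic_form_cong:
  assumes "\<And>u. u \<in> V \<Longrightarrow> x u = y u"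
  shows "quadratic_form V A x = quadratic_form V A y"
  using assms by (simp add: quadratic_form_def cong: sum.cong)

lemma quadratic_form_scale:
  "quadratic_form V A (\<lambda>u. c * x u) = c\<^sup>2 * quadratic_form V A x"
  by (simp add: quadratic_form_def sum_distrib_left power2_eq_square algebra_simps)

lemma quadratic_form_add_scaled:
  assumes sym: "\<And>u v. u \<in> V \<Longrightarrow> v \<in> V \<Longrightarrow> A u v = A v u"
  shows "quadratic_form V A (\<lambda>u. x u + t * g u) =
    quadratic_form V A x + 2 * t * (\<Sum>u\<in>V. g u * (\<Sum>v\<in>V. A u v * x v))
      + t\<^sup>2 * quadratic_form V A g"
proof -
  have "(\<Sum>u\<in>V. x u * (\<Sum>v\<in>V. A u v * g v)) = (\<Sum>u\<in>V. \<Sum>v\<in>V. A u v * x u * g v)"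
    by (simp add: sum_distrib_left algebra_simps)
  also have "\<dots> = (\<Sum>v\<in>V. \<Sum>u\<in>V. A u v * x u * g v)"
    by (rule sum.swap)
  also have "\<dots> = (\<Sum>v\<in>V. \<Sum>u\<in>V. A v u * x u * g v)"
    by (intro sum.cong refl) (simp add: sym)
  also have "\<dots> = (\<Sum>u\<in>V. g u * (\<Sum>v\<in>V. A u v * x v))"
    by (simp add: sum_distrib_left algebra_simps)
  finally have swap: "(\<Sum>u\<in>V. x u * (\<Sum>v\<in>V. A u v * g v)) =
    (\<Sum>u\<in>V. g u * (\<Sum>v\<in>V. A u v * x v))" .
  have "quadratic_form V A (\<lambda>u. x u + t * g u) =
    quadratic_form V A x + t * (\<Sum>u\<in>V. x u * (\<Sum>v\<in>V. A u v * g v))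
      + t * (\<Sum>u\<in>V. g u * (\<Sum>v\<in>V. A u v * x v)) + t\<^sup>2 * quadratic_form V A g"
    by (simp add: quadratic_form_def sum_distrib_left sum.distrib power2_eq_square algebra_simps)
  then show ?thesis by (simp add: swap)
qed

text \<open>
  Vectors indexed by \<open>V\<close> are functions that vanish off \<open>V\<close>.  In the product topology on all
  functions the sphere is then a closed subset of a product of copies of \<open>[-1, 1]\<close> and of points,
  which is compact by Tychonoff's theorem.
\<close>

lemma compact_unit_sphere_on:
  fixes V :: "'a set"
  assumes "finite V"
  shows "compact {x :: 'a \<Rightarrow> real. (\<forall>u. u \<notin> V \<longrightarrow> x u = 0) \<and> (\<Sum>u\<in>V. (x u)\<^sup>2) = 1}"
    (is "compact ?S")
proof -
  define B where "B = PiE UNIV (\<lambda>u. if u \<in> V then {-1..1::real} else {0})"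
  have B_mem: "x \<in> B \<longleftrightarrow> (\<forall>u. if u \<in> V then \<bar>x u\<bar> \<le> 1 else x u = 0)" for x
    unfolding B_def PiE_iff by (intro iffI allI conjI ballI; fastforce simp: abs_le_iff split: if_splits)
  have "compactin (product_topology (\<lambda>_. euclidean) UNIV) B"
    unfolding B_def compactin_PiE by auto
  then have "compact B" by (simp add: euclidean_product_topology)
  moreover have "closed {x :: 'a \<Rightarrow> real. (\<Sum>u\<in>V. (x u)\<^sup>2) = 1}"
    by (intro closed_Collect_eq continuous_intros continuous_on_product_coordinates)
  moreover have "?S = B \<inter> {x. (\<Sum>u\<in>V. (x u)\<^sup>2) = 1}"
  proof (rule Set.set_eqI)
    fix x :: "'a \<Rightarrow> real"
    have "\<bar>x u\<bar> \<le> 1" if "(\<Sum>u\<in>V. (x u)\<^sup>2) = 1" "u \<in> V" for u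
    proof -
      have "(x u)\<^sup>2 \<le> (\<Sum>u\<in>V. (x u)\<^sup>2)"
        using assms that by (intro member_le_sum) auto
      then show ?thesis using that by (simp add: abs_square_le_1)
    qed
    then show "x \<in> ?S \<longleftrightarrow> x \<in> B \<inter> {x. (\<Sum>u\<in>V. (x u)\<^sup>2) = 1}"
      by (auto simp: B_mem)
  qed
  ultimately show ?thesis by (simp add: compact_Int_closed)
qed

text \<open>
  Both sides of the inequality are homogeneous of degree \<open>2\<close>, so it is enough to take for \<open>\<mu>\<close> the
  maximum of the form on the compact unit sphere.
\<close>

lemma rayleigh_maximum_attained:
  fixes V :: "'a set"
  assumes fin: "finite V" and ne: "V \<noteq> {}"
  obtains \<mu> x where "\<And>y. quadratic_form V A y \<le> \<mu> * (\<Sum>u\<in>V. (y u)\<^sup>2)"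
    and "\<exists>u\<in>V. x u \<noteq> 0" and "quadratic_form V A x = \<mu> * (\<Sum>u\<in>V. (x u)\<^sup>2)"
proof -
  let ?S = "{x :: 'a \<Rightarrow> real. (\<forall>u. u \<notin> V \<longrightarrow> x u = 0) \<and> (\<Sum>u\<in>V. (x u)\<^sup>2) = 1}"
  obtain w where w: "w \<in> V" using ne by blast
  have "(\<Sum>u\<in>V. (if u = w then 1 else 0 :: real)\<^sup>2) = (\<Sum>u\<in>V. if u = w then 1 else 0)"
    by (intro sum.cong) auto
  then have "(\<lambda>u. if u = w then 1 else 0) \<in> ?S"
    using fin w by auto
  then have nonempty: "?S \<noteq> {}" by (metis empty_iff)
  have "continuous_on UNIV (quadratic_form V A)"
    unfolding quadratic_form_def
    by (intro continuous_intros continuous_on_product_coordinates)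
  then have cont: "continuous_on ?S (quadratic_form V A)"
    by (rule continuous_on_subset) simp
  obtain x where x: "x \<in> ?S"
    and max: "\<forall>y\<in>?S. quadratic_form V A y \<le> quadratic_form V A x"
    using continuous_attains_sup[OF compact_unit_sphere_on[OF fin] nonempty cont] by (rule bexE)
  show thesis
  proof
    fix y :: "'a \<Rightarrow> real"
    define N where "N = (\<Sum>u\<in>V. (y u)\<^sup>2)"
    show "quadratic_form V A y \<le> quadratic_form V A x * (\<Sum>u\<in>V. (y u)\<^sup>2)"
    proof (cases "N = 0")
      case True
      then have "y u = 0" if "u \<in> V" for u
        using that fin by (auto simp: N_def sum_nonneg_eq_0_iff)
      then show ?thesis by (simp add: quadratic_form_def)
    next
      case False
      moreover have "N \<ge> 0" by (simp add: N_def sum_nonneg)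
      ultimately have N: "N > 0" by simp
      define z where "z u = (if u \<in> V then (1 / sqrt N) * y u else 0)" for u
      have "(\<Sum>u\<in>V. (z u)\<^sup>2) = (\<Sum>u\<in>V. (y u)\<^sup>2 / N)"
        using N by (intro sum.cong) (auto simp: z_def power_divide)
      also have "\<dots> = 1" using N by (simp add: N_def flip: sum_divide_distrib)
      finally have "z \<in> ?S" by (auto simp: z_def)
      then have "quadratic_form V A z \<le> quadratic_form V A x" by (rule bspec[OF max])
      moreover have "quadratic_form V A z = quadratic_form V A (\<lambda>u. (1 / sqrt N) * y u)"
        by (rule quadratic_form_cong) (simp add: z_def)
      then have "quadratic_form V A z = quadratic_form V A y / N"
        unfolding quadratic_form_scale using N by (simp add: power_divide)
      ultimately show ?thesis using N by (simp add: N_def divide_le_eq)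
    qed
  next
    show "\<exists>u\<in>V. x u \<noteq> 0"
    proof (rule ccontr)
      assume "\<not> ?thesis"
      then have "(\<Sum>u\<in>V. (x u)\<^sup>2) = 0" by simp
      with x show False by simp
    qed
    show "quadratic_form V A x = quadratic_form V A x * (\<Sum>u\<in>V. (x u)\<^sup>2)"
      using x by simp
  qed
qed

text \<open>
  A maximiser of the Rayleigh quotient is an eigenvector: moving from \<open>x\<close> in the direction of the
  residual \<open>g = A x - \<mu> x\<close> changes the nonpositive quantity \<open>\<langle>A x, x\<rangle> - \<mu> \<langle>x, x\<rangle>\<close> at the rate
  \<open>2 * \<langle>g, g\<rangle>\<close>, which must therefore vanish.
\<close>

lemma rayleigh_equality:
  assumes fin: "finite V" and sym: "\<And>u v. u \<in> V \<Longrightarrow> v \<in> V \<Longrightarrow> A u v = A v u"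
    and le: "\<And>y. quadratic_form V A y \<le> \<mu> * (\<Sum>u\<in>V. (y u)\<^sup>2)"
    and eq: "quadratic_form V A x = \<mu> * (\<Sum>u\<in>V. (x u)\<^sup>2)"
    and u: "u \<in> V"
  shows "(\<Sum>v\<in>V. A u v * x v) = \<mu> * x u"
proof -
  define g where "g u = (\<Sum>v\<in>V. A u v * x v) - \<mu> * x u" for u
  define s where "s = (\<Sum>u\<in>V. (g u)\<^sup>2)"
  define q where "q = quadratic_form V A g - \<mu> * (\<Sum>u\<in>V. (g u)\<^sup>2)"
  have "q \<le> 0" using le[of g] by (simp add: q_def)
  have s: "s = (\<Sum>u\<in>V. g u * (\<Sum>v\<in>V. A u v * x v)) - \<mu> * (\<Sum>u\<in>V. g u * x u)"
  proof -
    have "s = (\<Sum>u\<in>V. g u * ((\<Sum>v\<in>V. A u v * x v) - \<mu> * x u))"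
      by (simp add: s_def power2_eq_square flip: g_def)
    then show ?thesis
      by (simp add: right_diff_distrib sum_subtractf sum_distrib_left mult.left_commute)
  qed
  have norm: "(\<Sum>u\<in>V. (x u + t * g u)\<^sup>2) =
      (\<Sum>u\<in>V. (x u)\<^sup>2) + 2 * t * (\<Sum>u\<in>V. g u * x u) + t\<^sup>2 * (\<Sum>u\<in>V. (g u)\<^sup>2)" for t
    by (simp add: power2_eq_square sum_distrib_left sum.distrib algebra_simps)
  have form: "quadratic_form V A (\<lambda>u. x u + t * g u) = \<mu> * (\<Sum>u\<in>V. (x u)\<^sup>2)
      + 2 * t * (\<Sum>u\<in>V. g u * (\<Sum>v\<in>V. A u v * x v)) + t\<^sup>2 * quadratic_form V A g" for t
    unfolding eq[symmetric] by (rule quadratic_form_add_scaled) (rule sym)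
  have expand: "2 * t * s + t\<^sup>2 * q =
      quadratic_form V A (\<lambda>u. x u + t * g u) - \<mu> * (\<Sum>u\<in>V. (x u + t * g u)\<^sup>2)" for t
    unfolding form norm q_def s by (simp add: algebra_simps)
  have nonpos: "2 * t * s + t\<^sup>2 * q \<le> 0" for t
    unfolding expand using le by simp
  have "s \<ge> 0" by (simp add: s_def sum_nonneg)
  have "s = 0"
  proof (rule ccontr)
    assume "s \<noteq> 0"
    with \<open>s \<ge> 0\<close> have s: "s > 0" by simp
    \<comment> \<open>A step short enough for the linear term \<open>2 * t * s\<close> to outweigh \<open>t\<^sup>2 * q\<close>.\<close>
    define t where "t = s / (1 - q)"
    have t: "t > 0" using s \<open>q \<le> 0\<close> by (simp add: t_def)
    have "t * (1 - q) = s" using \<open>q \<le> 0\<close> by (simp add: t_def)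
    then have tq: "t - t * q = s" by (simp add: right_diff_distrib)
    have "t * (2 * s + t * q) \<le> 0"
      using nonpos[of t] by (simp add: algebra_simps power2_eq_square)
    then have "2 * s + t * q \<le> 0" using t by (simp add: mult_le_0_iff)
    then show False using tq t s by linarith
  qed
  then have "g u = 0" using fin u by (auto simp: s_def sum_nonneg_eq_0_iff)
  then show ?thesis by (simp add: g_def)
qed

section \<open>The largest eigenvalue of a graph\<close>

abbreviation adjacency :: "('a, 'b) pre_digraph \<Rightarrow> 'a \<Rightarrow> 'a \<Rightarrow> real" where
  "adjacency G u v \<equiv> (if u \<rightarrow>\<^bsub>G\<^esub> v then 1 else 0)"

context graph
begin

lemma adjacency_commute: "adjacency G u v = adjacency G v u"
  using arcs_ends_symmetric[OF sym_arcs] by auto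

lemma in_graph_spectrum_iff:
  "k \<in> graph_spectrum G \<longleftrightarrow>
    (\<exists>f. (\<exists>u \<in> verts G. f u \<noteq> 0) \<and>
      (\<forall>u \<in> verts G. (\<Sum>v \<in> verts G. adjacency G u v * f v) = k * f u))"
proof -
  obtain vs where "vs \<in> vertex_orderings G"
    using finite_distinct_list[OF finite_verts] by (auto simp: vertex_orderings_def)
  then show ?thesis
    by (simp add: graph_spectrum_eq spectrum_adjacency_matrix_iff)
qed

lemma finite_graph_spectrum: "finite (graph_spectrum G)"
proof -
  obtain vs where "vs \<in> vertex_orderings G"
    using finite_distinct_list[OF finite_verts] by (auto simp: vertex_orderings_def)
  moreover have "adjacency_matrix G vs \<in> carrier_mat (length vs) (length vs)"
    by (simp add: adjacency_matrix_def)
  ultimately show ?thesis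
    using card_finite_spectrum(1) by (metis graph_spectrum_eq)
qed

text \<open>
  The maximum \<open>\<mu>\<close> of the Rayleigh quotient is itself an eigenvalue, hence at most the largest one.
\<close>

lemma rayleigh_largest_eigenvalue:
  assumes "verts G \<noteq> {}"
  shows "quadratic_form (verts G) (adjacency G) y \<le>
      largest_eigenvalue G * (\<Sum>u\<in>verts G. (y u)\<^sup>2)"
    and "largest_eigenvalue G \<in> graph_spectrum G"
proof -
  obtain \<mu> x where le: "\<And>y. quadratic_form (verts G) (adjacency G) y \<le> \<mu> * (\<Sum>u\<in>verts G. (y u)\<^sup>2)"
    and x: "\<exists>u\<in>verts G. x u \<noteq> 0"
    and eq: "quadratic_form (verts G) (adjacency G) x = \<mu> * (\<Sum>u\<in>verts G. (x u)\<^sup>2)"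
    using rayleigh_maximum_attained[OF finite_verts assms] by blast
  have "\<forall>u\<in>verts G. (\<Sum>v\<in>verts G. adjacency G u v * x v) = \<mu> * x u"
    using rayleigh_equality[of _ "adjacency G", OF finite_verts adjacency_commute le eq] by blast
  with x have \<mu>: "\<mu> \<in> graph_spectrum G" using in_graph_spectrum_iff by blast
  then show "largest_eigenvalue G \<in> graph_spectrum G"
    unfolding largest_eigenvalue_def using finite_graph_spectrum by (intro Max_in) auto
  have "\<mu> \<le> largest_eigenvalue G"
    unfolding largest_eigenvalue_def using finite_graph_spectrum \<mu> by (rule Max_ge)
  then have "\<mu> * (\<Sum>u\<in>verts G. (y u)\<^sup>2) \<le> largest_eigenvalue G * (\<Sum>u\<in>verts G. (y u)\<^sup>2)"
    by (intro mult_right_mono sum_nonneg) auto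
  with le[of y] show "quadratic_form (verts G) (adjacency G) y \<le>
      largest_eigenvalue G * (\<Sum>u\<in>verts G. (y u)\<^sup>2)" by linarith
qed

lemma out_degree_eq_sum_adjacency:
  "real (out_degree G u) = (\<Sum>v\<in>verts G. adjacency G u v)"
proof -
  have "bij_betw (head G) (out_arcs G u) {v \<in> verts G. u \<rightarrow>\<^bsub>G\<^esub> v}"
    unfolding bij_betw_def
  proof
    show "inj_on (head G) (out_arcs G u)"
      by (auto simp: inj_on_def arc_to_ends_def intro: no_multi_arcs)
    show "head G ` out_arcs G u = {v \<in> verts G. u \<rightarrow>\<^bsub>G\<^esub> v}"
      by (auto simp: arcs_ends_conv)
  qed
  then have "out_degree G u = card {v \<in> verts G. u \<rightarrow>\<^bsub>G\<^esub> v}"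
    unfolding out_degree_def by (rule bij_betw_same_card)
  then show ?thesis
    by (simp add: sum.If_cases Int_def)
qed

lemma quadratic_form_one:
  "quadratic_form (verts G) (adjacency G) (\<lambda>_. 1) = (\<Sum>u\<in>verts G. real (out_degree G u))"
  by (simp add: quadratic_form_def out_degree_eq_sum_adjacency)

text \<open>
  At a vertex \<open>u\<close> where an eigenvector \<open>f\<close> has its largest absolute value, the eigenvalue
  equation bounds \<open>\<theta> * \<bar>f u\<bar>\<close> by the sum of \<open>\<bar>f v\<bar> \<le> \<bar>f u\<bar>\<close> over the neighbours \<open>v\<close>.
\<close>

lemma eigenvalue_le_degree_bound:
  assumes "\<theta> \<in> graph_spectrum G" and k: "\<And>u. u \<in> verts G \<Longrightarrow> real (out_degree G u) \<le> k"
  shows "\<theta> \<le> k"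
proof -
  obtain f w where w: "w \<in> verts G" "f w \<noteq> 0"
    and f: "\<And>u. u \<in> verts G \<Longrightarrow> (\<Sum>v \<in> verts G. adjacency G u v * f v) = \<theta> * f u"
    using assms(1) in_graph_spectrum_iff by blast
  obtain u where u: "u \<in> verts G" and max: "\<And>v. v \<in> verts G \<Longrightarrow> \<bar>f v\<bar> \<le> \<bar>f u\<bar>"
  proof -
    have ne: "(\<lambda>v. \<bar>f v\<bar>) ` verts G \<noteq> {}" using w by blast
    have fin: "finite ((\<lambda>v. \<bar>f v\<bar>) ` verts G)" by simp
    from Max_in[OF fin ne] obtain u
      where "u \<in> verts G" "Max ((\<lambda>v. \<bar>f v\<bar>) ` verts G) = \<bar>f u\<bar>" by auto
    with Max_ge[OF fin] that show thesis by fastforce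
  qed
  have pos: "\<bar>f u\<bar> > 0" using max[OF w(1)] w(2) by linarith
  have "\<theta> * \<bar>f u\<bar> \<le> \<bar>\<theta> * f u\<bar>" by (simp add: abs_mult mult_right_mono)
  also have "\<dots> \<le> (\<Sum>v \<in> verts G. \<bar>adjacency G u v * f v\<bar>)"
    unfolding f[OF u, symmetric] by (rule sum_abs)
  also have "\<dots> \<le> (\<Sum>v \<in> verts G. adjacency G u v * \<bar>f u\<bar>)"
    using max by (intro sum_mono) auto
  also have "\<dots> = real (out_degree G u) * \<bar>f u\<bar>"
    by (simp add: out_degree_eq_sum_adjacency sum_distrib_right)
  also have "\<dots> \<le> k * \<bar>f u\<bar>"
    using k[OF u] by (simp add: mult_right_mono)
  finally show ?thesis using pos by simp
qed

lemma largest_eigenvalue_regular: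
  assumes "verts G \<noteq> {}" and deg: "\<And>u. u \<in> verts G \<Longrightarrow> out_degree G u = k"
  shows "largest_eigenvalue G = real k"
proof (rule antisym)
  show "largest_eigenvalue G \<le> real k"
    by (rule eigenvalue_le_degree_bound[OF rayleigh_largest_eigenvalue(2)[OF assms(1)]])
      (simp add: deg)
  have "(\<Sum>u\<in>verts G. real (out_degree G u)) = real k * real (card (verts G))"
    by (simp add: deg)
  then have "real k * real (card (verts G)) \<le> largest_eigenvalue G * real (card (verts G))"
    using rayleigh_largest_eigenvalue(1)[OF assms(1), of "\<lambda>_. 1"]
    by (simp add: quadratic_form_one)
  then show "real k \<le> largest_eigenvalue G"
    using assms(1) by (simp add: card_gt_0_iff)
qed

section \<open>Edges and the diminished Sombor index\<close>

lemma edgesE: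
  assumes "e \<in> edges G"
  obtains u v where "e = {u, v}" "u \<noteq> v" "u \<in> verts G" "v \<in> verts G"
    "out_degree G u > 0" "out_degree G v > 0"
proof -
  obtain a where a: "a \<in> arcs G" "e = {tail G a, head G a}"
    using assms by (auto simp: edges_def)
  obtain b where b: "b \<in> arcs G" "tail G b = head G a"
    using sym_arcs a by (metis symmetric_conv)
  have "out_degree G (tail G c) > 0" if "c \<in> arcs G" for c
    using that by (auto simp: out_degree_def card_gt_0_iff)
  from this[OF a(1)] this[OF b(1)] a b no_loops[OF a(1)] show thesis
    by (intro that[of "tail G a" "head G a"]) auto
qed

text \<open>The handshake lemma: every edge is the set of ends of exactly two arcs.\<close>

lemma sum_out_degree_eq_edges: "(\<Sum>u\<in>verts G. out_degree G u) = 2 * card (edges G)"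
proof -
  let ?h = "\<lambda>a. {tail G a, head G a}"
  have "card {a \<in> arcs G. ?h a = e} = 2" if e: "e \<in> edges G" for e
  proof -
    obtain a where a: "a \<in> arcs G" "e = ?h a"
      using e by (auto simp: edges_def)
    obtain b where b: "b \<in> arcs G" "tail G b = head G a" "head G b = tail G a"
      using sym_arcs a by (metis symmetric_conv)
    have "c = a \<or> c = b" if "c \<in> arcs G" "?h c = e" for c
      using that a b no_multi_arcs[of c a] no_multi_arcs[of c b]
      by (auto simp: arc_to_ends_def doubleton_eq_iff)
    then have "{a \<in> arcs G. ?h a = e} = {a, b}"
      using a b by auto
    moreover have "a \<noteq> b" using b no_loops[OF a(1)] by auto
    ultimately show ?thesis by simp
  qed
  moreover have "card (arcs G) = (\<Sum>e\<in>edges G. card {a \<in> arcs G. ?h a = e})"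
    using sum.image_gen[of "arcs G" "\<lambda>_. 1::nat" ?h] by (simp add: edges_def)
  moreover have "card (arcs G) = (\<Sum>u\<in>verts G. card {a \<in> arcs G. tail G a = u})"
    using sum.group[of "arcs G" "verts G" "tail G" "\<lambda>_. 1::nat"]
    by (simp add: image_subset_iff)
  ultimately show ?thesis
    by (simp add: out_degree_def out_arcs_def)
qed

end

text \<open>
  After squaring and cancelling, the claim becomes \<open>0 \<le> (a * D - b * d) * (b * D - a * d)\<close>,
  where both factors are nonnegative: \<open>a\<close> and \<open>b\<close> lie between \<open>d\<close> and \<open>D\<close>.
\<close>

lemma sombor_quotient_le:
  fixes a b d D :: real
  assumes "0 \<le> d" "d \<le> a" "a \<le> D" "d \<le> b" "b \<le> D" "0 < a" "0 < b"
  shows "sqrt (a\<^sup>2 + b\<^sup>2) / (a + b) \<le> sqrt (D\<^sup>2 + d\<^sup>2) / (D + d)"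
proof -
  have "b * d \<le> D * a" "a * d \<le> D * b"
    using assms by (auto intro!: mult_mono)
  then have "0 \<le> (a * D - b * d) * (b * D - a * d)"
    by (simp add: mult.commute)
  also have "2 * \<dots> = (D\<^sup>2 + d\<^sup>2) * (a + b)\<^sup>2 - (a\<^sup>2 + b\<^sup>2) * (D + d)\<^sup>2"
    by (simp add: power2_eq_square algebra_simps)
  finally have "(a\<^sup>2 + b\<^sup>2) * (D + d)\<^sup>2 \<le> (D\<^sup>2 + d\<^sup>2) * (a + b)\<^sup>2" by simp
  then have "sqrt ((a\<^sup>2 + b\<^sup>2) * (D + d)\<^sup>2) \<le> sqrt ((D\<^sup>2 + d\<^sup>2) * (a + b)\<^sup>2)"
    by (rule real_sqrt_le_mono)
  then have "sqrt (a\<^sup>2 + b\<^sup>2) * (D + d) \<le> sqrt (D\<^sup>2 + d\<^sup>2) * (a + b)"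
    using assms by (simp add: real_sqrt_mult)
  then show ?thesis
    using assms by (simp add: divide_le_eq pos_le_divide_eq field_simps)
qed

lemma (in graph) DSO_le_card_edges:
  fixes d D :: real
  assumes "0 \<le> d"
    and "\<And>u. u \<in> verts G \<Longrightarrow> d \<le> real (out_degree G u) \<and> real (out_degree G u) \<le> D"
  shows "DSO G \<le> real (card (edges G)) * (sqrt (D\<^sup>2 + d\<^sup>2) / (D + d))"
  unfolding DSO_def
proof (rule sum_bounded_above)
  fix e assume "e \<in> edges G"
  then obtain u v where "e = {u, v}" "u \<noteq> v" "u \<in> verts G" "v \<in> verts G"
    "out_degree G u > 0" "out_degree G v > 0" by (rule edgesE)
  then show "sqrt (\<Sum>w\<in>e. (real (out_degree G w))\<^sup>2) / (\<Sum>w\<in>e. real (out_degree G w))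
      \<le> sqrt (D\<^sup>2 + d\<^sup>2) / (D + d)"
    using assms sombor_quotient_le[of d "real (out_degree G u)" D "real (out_degree G v)"] by simp
qed

lemma (in graph) DSO_regular:
  assumes deg: "\<And>u. u \<in> verts G \<Longrightarrow> out_degree G u = k"
  shows "DSO G = real (card (edges G)) * (sqrt ((real k)\<^sup>2 + (real k)\<^sup>2) / (real k + real k))"
proof -
  have "sqrt (\<Sum>w\<in>e. (real (out_degree G w))\<^sup>2) / (\<Sum>w\<in>e. real (out_degree G w)) =
      sqrt ((real k)\<^sup>2 + (real k)\<^sup>2) / (real k + real k)" if e: "e \<in> edges G" for e
  proof -
    obtain u v where "e = {u, v}" "u \<noteq> v" "u \<in> verts G" "v \<in> verts G"
      using e by (rule edgesE)
    then show ?thesis by (simp add: deg)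
  qed
  then show ?thesis by (simp add: DSO_def)
qed

section \<open>The bound and its equality case\<close>

theorem corollary1:
  fixes G :: "('a, 'b) pre_digraph" and n :: nat and \<Delta> \<delta> lam\<^sub>1 :: real
  assumes "graph G" and "Digraph_Component.connected G" and "edges G \<noteq> {}"
    and "n = card (verts G)"
    and "\<Delta> = real (max_degree G)" and "\<delta> = real (min_degree G)"
    and "lam\<^sub>1 = largest_eigenvalue G"
  shows "DSO G \<le> real n * lam\<^sub>1 / 2 * (sqrt (\<Delta>\<^sup>2 + \<delta>\<^sup>2) / (\<Delta> + \<delta>))
    \<and> (DSO G = real n * lam\<^sub>1 / 2 * (sqrt (\<Delta>\<^sup>2 + \<delta>\<^sup>2) / (\<Delta> + \<delta>)) \<longleftrightarrow> regular_graph G)"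
proof -
  interpret graph G by fact
  let ?V = "verts G" and ?m = "real (card (edges G))"
  define S where "S = sqrt (\<Delta>\<^sup>2 + \<delta>\<^sup>2) / (\<Delta> + \<delta>)"
  obtain w where w: "w \<in> ?V" "out_degree G w > 0"
    using assms(3) by (metis all_not_in_conv edgesE)
  then have ne: "?V \<noteq> {}" by blast
  have bounds: "\<delta> \<le> real (out_degree G u) \<and> real (out_degree G u) \<le> \<Delta>" if "u \<in> ?V" for u
    using that by (simp add: assms(5,6) max_degree_def min_degree_def)
  have \<delta>: "\<delta> \<ge> 0" by (simp add: assms(6))
  have "\<Delta> > 0" using bounds[OF w(1)] w(2) by linarith
  with \<delta> have S: "S > 0" by (simp add: S_def add_pos_nonneg)
  have DSO: "DSO G \<le> ?m * S"
    unfolding S_def by (rule DSO_le_card_edges[OF \<delta> bounds])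
  have "(\<Sum>u\<in>?V. real (out_degree G u)) = 2 * ?m"
    using arg_cong[OF sum_out_degree_eq_edges, of real] by simp
  then have form_one: "quadratic_form ?V (adjacency G) (\<lambda>_. 1) = 2 * ?m"
    by (simp add: quadratic_form_one)
  have "2 * ?m \<le> lam\<^sub>1 * real n"
    using rayleigh_largest_eigenvalue(1)[OF ne, of "\<lambda>_. 1"] assms(4,7) by (simp add: form_one)
  then have m: "?m \<le> real n * lam\<^sub>1 / 2" by (simp add: mult.commute)
  then have mS: "?m * S \<le> real n * lam\<^sub>1 / 2 * S"
    using S by (intro mult_right_mono) auto
  have "DSO G = real n * lam\<^sub>1 / 2 * S \<longleftrightarrow> regular_graph G"
  proof
    assume "DSO G = real n * lam\<^sub>1 / 2 * S"
    with DSO mS have "?m * S = real n * lam\<^sub>1 / 2 * S" by linarith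
    with S have "2 * ?m = lam\<^sub>1 * real n" by (simp add: mult.commute)
    then have eq: "quadratic_form ?V (adjacency G) (\<lambda>_. 1) =
        largest_eigenvalue G * (\<Sum>u\<in>?V. 1\<^sup>2)"
      by (simp add: form_one assms(4,7))
    have deg: "real (out_degree G u) = largest_eigenvalue G" if "u \<in> ?V" for u
      using rayleigh_equality[of _ "adjacency G", OF finite_verts adjacency_commute
          rayleigh_largest_eigenvalue(1)[OF ne] eq that]
      by (simp add: out_degree_eq_sum_adjacency)
    have "out_degree G u = out_degree G w" if "u \<in> ?V" for u
      using deg[OF that] deg[OF w(1)] by simp
    then show "regular_graph G" by (auto simp: regular_graph_def)
  next
    assume "regular_graph G"
    then obtain k where k: "\<And>u. u \<in> ?V \<Longrightarrow> out_degree G u = k"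
      by (auto simp: regular_graph_def)
    then have "out_degree G ` ?V = {k}" using ne by auto
    then have "\<Delta> = real k" "\<delta> = real k"
      by (simp_all add: assms(5,6) max_degree_def min_degree_def)
    then have "DSO G = ?m * S"
      using DSO_regular[OF k] by (simp add: S_def)
    moreover have "2 * card (edges G) = k * card ?V"
      using sum_out_degree_eq_edges k by (simp add: mult.commute)
    then have "2 * ?m = real k * real n"
      by (metis assms(4) of_nat_mult of_nat_numeral)
    moreover have "lam\<^sub>1 = real k"
      using largest_eigenvalue_regular[OF ne k] assms(7) by simp
    ultimately show "DSO G = real n * lam\<^sub>1 / 2 * S" by (simp add: mult.commute)
  qed
  with DSO mS show ?thesis by (simp add: S_def)
qed

end
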